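(* For all integers $j \geq 2$ and $n \geq 1$, \[ m_j(K_4, nK_2) = \begin{cases} \infty & \text{if } j \in \{2,3\}, \\ \left\lceil \dfrac{2n}{j-2} \right\rceil & \text{otherwise (i.e. } j\geq 4\text{)}. \end{cases} \]
   Context: All graphs are finite, simple and undirected. $K_4$ is the complete graph on $4$ vertices and $nK_2$ is a set of $n$ pairwise vertex-disjoint edges (a matching of size $n$). $K_{j\times t}$ denotes the complete multipartite graph with $j$ partite sets, each having $t$ vertices. For graphs $G_1,G_2$, the multipartite Ramsey number $m_j(G_1,G_2)$ is the smallest positive integer $t$ such that for every 2-edge-coloring $(G^1,G^2)$ of $K_{j\times t}$ (that is, every partition of the edge set into two color classes, $G^i$ being the spanning subgraph formed by the edges of color $i$), $G^i$ contains a copy of $G_i$ as a (not necessarily induced) subgraph for at least one $i\in\{1,2\}$; $m_j(G_1,G_2)=\infty$ means that no such $t$ exists. *)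

theory Defs
  imports Complex_Main "HOL-Library.Extended_Nat"
begin

record 'a graph =
  verts :: "'a set"
  edges :: "'a set set"

definition complete_graph :: "nat \<Rightarrow> nat graph" where
  "complete_graph k = \<lparr>verts = {..<k}, edges = {{u, v} | u v. u < k \<and> v < k \<and> u \<noteq> v}\<rparr>"

definition matching_graph :: "nat \<Rightarrow> nat graph" where
  "matching_graph n = \<lparr>verts = {..<2 * n}, edges = {{2 * i, 2 * i + 1} | i. i < n}\<rparr>"

text \<open>The vertex \<open>(p, i)\<close> is the \<open>i\<close>-th vertex of the partite set \<open>p\<close>.\<close>

definition complete_multipartite :: "nat \<Rightarrow> nat \<Rightarrow> (nat \<times> nat) graph" where
  "complete_multipartite j t =
     \<lparr>verts = {..<j} \<times> {..<t},
      edges = {{u, v} | u v. u \<in> {..<j} \<times> {..<t} \<and> v \<in> {..<j} \<times> {..<t} \<and> fst u \<noteq> fst v}\<rparr>"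

text \<open>A not necessarily induced copy of \<open>H\<close> in \<open>G\<close>.\<close>

definition contains_copy :: "'a graph \<Rightarrow> 'b graph \<Rightarrow> bool" where
  "contains_copy G H \<longleftrightarrow>
     (\<exists>f. inj_on f (verts H) \<and> f ` verts H \<subseteq> verts G \<and> (\<forall>e\<in>edges H. f ` e \<in> edges G))"

text \<open>A colour class may be empty.\<close>

definition two_edge_coloring :: "'a graph \<Rightarrow> 'a graph \<Rightarrow> 'a graph \<Rightarrow> bool" where
  "two_edge_coloring G R B \<longleftrightarrow>
     verts R = verts G \<and> verts B = verts G \<and>
     edges R \<union> edges B = edges G \<and> edges R \<inter> edges B = {}"

definition multipartite_arrows :: "nat \<Rightarrow> nat \<Rightarrow> 'a graph \<Rightarrow> 'b graph \<Rightarrow> bool" where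
  "multipartite_arrows j t G\<^sub>1 G\<^sub>2 \<longleftrightarrow>
     (\<forall>R B. two_edge_coloring (complete_multipartite j t) R B \<longrightarrow>
        contains_copy R G\<^sub>1 \<or> contains_copy B G\<^sub>2)"

definition multipartite_ramsey :: "nat \<Rightarrow> 'a graph \<Rightarrow> 'b graph \<Rightarrow> enat" where
  "multipartite_ramsey j G\<^sub>1 G\<^sub>2 =
     (if \<exists>t\<ge>1. multipartite_arrows j t G\<^sub>1 G\<^sub>2
      then enat (LEAST t. t \<ge> 1 \<and> multipartite_arrows j t G\<^sub>1 G\<^sub>2)
      else \<infinity>)"

end

theory Submission
  imports Defs
begin

text \<open>
  Lower bound: colour blue exactly the edges between parts with index at least 2. Merging these
  parts into one makes red tripartite, hence free of \<open>K\<^sub>4\<close>, and blue lives on \<open>(j - 2) t\<close> vertices.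

  Upper bound: assume \<open>2 n \<le> (j - 2) t\<close>, no red \<open>K\<^sub>4\<close> and no blue \<open>n K\<^sub>2\<close>. A maximum blue matching
  leaves a set \<open>U\<close> of at least \<open>2 t + 2\<close> vertices uncovered, and all edges inside \<open>U\<close> are red. So \<open>U\<close>
  meets exactly three parts, each in at least two vertices. A vertex outside these parts is joined in
  blue to all of \<open>U\<close> within one of them, otherwise it completes a red \<open>K\<^sub>4\<close>; in particular it has
  two blue neighbours in \<open>U\<close>. If the matching paired two such vertices, it could be augmented.
  Hence the \<open>t\<close> vertices of a fourth part are matched into the three parts outside \<open>U\<close>, which
  gives \<open>t + |U| \<le> 3 t\<close>, a contradiction.
\<close>

section \<open>Edges of the multipartite graph and copies of the two target graphs\<close>

lemma verts_complete_multipartite [simp]: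
  "verts (complete_multipartite j t) = {..<j} \<times> {..<t}"
  by (simp add: complete_multipartite_def)

lemma doubleton_in_edges_complete_multipartite [simp]:
  "{u, v} \<in> edges (complete_multipartite j t) \<longleftrightarrow>
     u \<in> {..<j} \<times> {..<t} \<and> v \<in> {..<j} \<times> {..<t} \<and> fst u \<noteq> fst v"
proof
  show "u \<in> {..<j} \<times> {..<t} \<and> v \<in> {..<j} \<times> {..<t} \<and> fst u \<noteq> fst v"
    if "{u, v} \<in> edges (complete_multipartite j t)"
    using that by (auto simp: complete_multipartite_def doubleton_eq_iff)
qed (unfold complete_multipartite_def graph.simps, blast)

lemma edges_complete_multipartiteE:
  assumes "e \<in> edges (complete_multipartite j t)"
  obtains u v where "e = {u, v}" "u \<in> {..<j} \<times> {..<t}" "v \<in> {..<j} \<times> {..<t}" "fst u \<noteq> fst v"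
  using assms by (auto simp: complete_multipartite_def)

lemma contains_copy_complete_graphI:
  assumes "S \<subseteq> verts G" "finite S" "card S = k"
    and "\<And>x y. x \<in> S \<Longrightarrow> y \<in> S \<Longrightarrow> x \<noteq> y \<Longrightarrow> {x, y} \<in> edges G"
  shows "contains_copy G (complete_graph k)"
proof -
  obtain h where h: "bij_betw h {..<k} S"
    using ex_bij_betw_nat_finite[OF assms(2)] assms(3) by (auto simp: atLeast0LessThan)
  have "{h u, h v} \<in> edges G" if "u < k" "v < k" "u \<noteq> v" for u v
    using that h assms(4) by (auto simp: bij_betw_def inj_on_def)
  then show ?thesis
    using h assms(1) unfolding contains_copy_def complete_graph_def
    by (intro exI[of _ h]) (auto simp: bij_betw_def)
qed

lemma contains_copy_matching_graphI:
  assumes M: "M \<subseteq> edges G" "finite M" "pairwise disjnt M" "n \<le> card M"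
    and G: "\<And>e. e \<in> edges G \<Longrightarrow> card e = 2 \<and> e \<subseteq> verts G"
  shows "contains_copy G (matching_graph n)"
proof -
  obtain h where h: "bij_betw h {..<card M} M"
    using ex_bij_betw_nat_finite[OF M(2)] by (auto simp: atLeast0LessThan)
  have "\<forall>e. \<exists>a b. e \<in> M \<longrightarrow> e = {a, b} \<and> a \<noteq> b"
    using M(1) G by (meson card_2_iff subsetD)
  then obtain a b where ab: "\<And>e. e \<in> M \<Longrightarrow> e = {a e, b e} \<and> a e \<noteq> b e"
    by metis
  \<comment> \<open>Vertices \<open>2 * i\<close> and \<open>2 * i + 1\<close> of the matching go to
    the two ends of the edge \<open>h i\<close>: \<open>k div 2\<close> selects the edge, the parity
    of \<open>k\<close> its end.\<close>
  define f where "f k = (if even k then a else b) (h (k div 2))" for k :: nat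
  have hM: "h (k div 2) \<in> M" if "k < 2 * n" for k
    using h M(4) that by (auto simp: bij_betw_def)
  have f_in: "f k \<in> h (k div 2)" if "k < 2 * n" for k
    using ab[OF hM[OF that]] by (auto simp: f_def)
  have "inj_on f {..<2 * n}"
  proof (rule inj_onI)
    fix k l assume kl: "k \<in> {..<2 * n}" "l \<in> {..<2 * n}" and eq: "f k = f l"
    have "\<not> disjnt (h (k div 2)) (h (l div 2))"
      using f_in[of k] f_in[of l] kl eq by (auto simp: disjnt_def)
    then have heq: "h (k div 2) = h (l div 2)"
      using M(3) hM[of k] hM[of l] kl by (auto simp: pairwise_def)
    moreover have "k div 2 < card M" "l div 2 < card M"
      using kl M(4) by auto
    ultimately have "k div 2 = l div 2"
      using h by (auto simp: bij_betw_def inj_on_def)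
    moreover have "even k \<longleftrightarrow> even l"
      using eq heq ab[OF hM[of k]] kl by (auto simp: f_def split: if_splits)
    ultimately show "k = l"
      by (metis dvd_mult_div_cancel odd_two_times_div_two_succ)
  qed
  moreover have "f ` {..<2 * n} \<subseteq> verts G"
    using f_in hM M(1) G by blast
  moreover have "f ` {2 * i, 2 * i + 1} \<in> edges G" if "i < n" for i
    using ab[OF hM[of "2 * i"]] hM[of "2 * i"] M(1) that by (auto simp: f_def)
  ultimately show ?thesis
    unfolding contains_copy_def matching_graph_def by (intro exI[of _ f]) auto
qed

section \<open>Augmenting and maximizing matchings\<close>

text \<open>On the path \<open>u\<close>, \<open>v\<close>, \<open>w\<close>, \<open>u'\<close> only
  the middle edge belongs to \<open>M\<close>. Exchanging it for the two outer edges gains one edge;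
  these are disjoint because \<open>u\<close> and \<open>u'\<close> differ.\<close>

lemma matching_augment:
  assumes M: "finite M" "pairwise disjnt M"
    and vw: "{v, w} \<in> M" "v \<noteq> w"
    and u: "u \<notin> \<Union>M" "u' \<notin> \<Union>M" "u \<noteq> u'"
  defines "N \<equiv> insert {v, u} (insert {w, u'} (M - {{v, w}}))"
  shows "pairwise disjnt N" "card N = Suc (card M)"
proof -
  have out: "v \<notin> e \<and> w \<notin> e" if "e \<in> M - {{v, w}}" for e
    using pairwiseD[OF M(2) _ vw(1), of e] that by (auto simp: disjnt_def)
  have "v \<noteq> u" "v \<noteq> u'" "w \<noteq> u" "w \<noteq> u'"
    using vw u by auto
  moreover have "pairwise disjnt (M - {{v, w}})"
    using M(2) by (rule pairwise_subset) auto
  ultimately show "pairwise disjnt N"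
    using out u vw(2) by (auto simp: N_def pairwise_insert disjnt_def)
  have "{v, u} \<notin> insert {w, u'} (M - {{v, w}})" "{w, u'} \<notin> M - {{v, w}}"
    using u vw by (auto simp: doubleton_eq_iff)
  then have "card N = Suc (Suc (card (M - {{v, w}})))"
    using M(1) by (simp add: N_def)
  then show "card N = Suc (card M)"
    using M(1) vw(1) by (metis card_Suc_Diff1)
qed

lemma maximum_matching_exists:
  assumes "finite F"
  obtains M where "M \<subseteq> F" "pairwise disjnt M"
    "\<And>N. N \<subseteq> F \<Longrightarrow> pairwise disjnt N \<Longrightarrow> card N \<le> card M"
proof -
  have "\<exists>M. (M \<subseteq> F \<and> pairwise disjnt M) \<and>
      (\<forall>N. N \<subseteq> F \<and> pairwise disjnt N \<longrightarrow> card N \<le> card M)"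
    \<comment> \<open>The empty matching is the initial witness, and \<open>Suc (card F)\<close>
      strictly bounds all sizes.\<close>
    by (rule ex_has_greatest_nat[of _ "{}" _ "Suc (card F)"])
      (auto simp: less_Suc_eq_le intro: card_mono assms)
  then show ?thesis
    using that by blast
qed

section \<open>Lower bound\<close>

lemma not_multipartite_arrows:
  assumes "n \<ge> 1" and small: "j \<le> 3 \<or> (j - 2) * t < 2 * n"
  shows "\<not> multipartite_arrows j t (complete_graph 4) (matching_graph n)"
proof
  let ?G = "complete_multipartite j t"
  \<comment> \<open>\<open>c\<close> contracts all parts of index at least 2 to one class. An edge
    is red iff its ends lie in different classes, that is, iff its image under \<open>c\<close> has
    two elements.\<close>
  define c :: "nat \<times> nat \<Rightarrow> nat" where "c x = min (fst x) 2" for x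
  define E where "E = {e \<in> edges ?G. card (c ` e) = 2}"
  define R where "R = \<lparr>verts = verts ?G, edges = E\<rparr>"
  define B where "B = \<lparr>verts = verts ?G, edges = edges ?G - E\<rparr>"
  assume "multipartite_arrows j t (complete_graph 4) (matching_graph n)"
  moreover have "two_edge_coloring ?G R B"
    by (auto simp: two_edge_coloring_def R_def B_def E_def)
  ultimately consider "contains_copy R (complete_graph 4)" | "contains_copy B (matching_graph n)"
    unfolding multipartite_arrows_def by blast
  then show False
  proof cases
    case 1
    then obtain f where f: "\<forall>e \<in> edges (complete_graph 4). f ` e \<in> E"
      by (auto simp: contains_copy_def R_def)
    \<comment> \<open>A red \<open>complete_graph 4\<close> would need four different values of
      \<open>c\<close>, which takes only three.\<close>
    have "inj_on (\<lambda>i. c (f i)) {..<4::nat}"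
    proof (rule inj_onI, rule ccontr)
      fix x y :: nat
      assume xy: "x \<in> {..<4}" "y \<in> {..<4}" "c (f x) = c (f y)" "x \<noteq> y"
      then have "{x, y} \<in> edges (complete_graph 4)"
        by (auto simp: complete_graph_def)
      then have "f ` {x, y} \<in> E"
        using f by blast
      then show False
        using xy by (simp add: E_def)
    qed
    then have "card {..<4::nat} \<le> card {..<3::nat}"
      by (rule card_inj_on_le) (auto simp: c_def)
    then show False
      by simp
  next
    case 2
    then obtain f where inj: "inj_on f {..<2 * n}"
      and f: "\<forall>e \<in> edges (matching_graph n). f ` e \<in> edges ?G - E"
      by (auto simp: contains_copy_def B_def matching_graph_def)
    \<comment> \<open>A blue edge joins two different parts of index at least 2, so one such edge
      already forces \<open>j > 3\<close>. This settles \<open>j \<le> 3\<close> for every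
      \<open>t\<close>; for larger \<open>j\<close> the vertex count decides.\<close>
    have edge: "j > 3 \<and> f ` {2 * i, 2 * i + 1} \<subseteq> {2..<j} \<times> {..<t}" if "i < n" for i
    proof -
      have "{2 * i, 2 * i + 1} \<in> edges (matching_graph n)"
        using that by (auto simp: matching_graph_def)
      then have e: "f ` {2 * i, 2 * i + 1} \<in> edges ?G" "f ` {2 * i, 2 * i + 1} \<notin> E"
        using f by blast+
      from e(1) obtain u v where uv: "f ` {2 * i, 2 * i + 1} = {u, v}"
        "u \<in> {..<j} \<times> {..<t}" "v \<in> {..<j} \<times> {..<t}" "fst u \<noteq> fst v"
        by (rule edges_complete_multipartiteE)
      have "card (c ` {u, v}) \<noteq> 2"
        using e unfolding uv(1) E_def by blast
      then have "c u = c v"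
        by (auto simp: card_insert_if split: if_splits)
      then have "fst u \<ge> 2" "fst v \<ge> 2"
        using uv(4) by (auto simp: c_def min_def split: if_splits)
      then show ?thesis
        unfolding uv(1) using uv(2-4) by (auto simp: mem_Times_iff)
    qed
    have "f ` {..<2 * n} \<subseteq> {2..<j} \<times> {..<t}"
    proof (rule image_subsetI)
      fix k assume "k \<in> {..<2 * n}"
      then have "k div 2 < n"
        by auto
      moreover have "k \<in> {2 * (k div 2), 2 * (k div 2) + 1}"
        by auto
      ultimately show "f k \<in> {2..<j} \<times> {..<t}"
        using edge by blast
    qed
    from card_mono[OF _ this] have "2 * n \<le> (j - 2) * t"
      using inj by (simp add: card_image)
    moreover have "j > 3"
      using edge[of 0] assms(1) by simp
    ultimately show False
      using small by auto
  qed
qed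

section \<open>Upper bound\<close>

lemma multipartite_arrows_K4_matching:
  assumes j: "j \<ge> 4" and large: "2 * n \<le> (j - 2) * t"
  shows "multipartite_arrows j t (complete_graph 4) (matching_graph n)"
  unfolding multipartite_arrows_def
proof (intro allI impI, rule ccontr)
  fix R B :: "(nat \<times> nat) graph"
  let ?G = "complete_multipartite j t"
  define V where "V = {..<j} \<times> {..<t}"
  define F where "F = edges B"
  assume col: "two_edge_coloring ?G R B"
    and "\<not> (contains_copy R (complete_graph 4) \<or> contains_copy B (matching_graph n))"
  then have noR: "\<not> contains_copy R (complete_graph 4)"
    and noB: "\<not> contains_copy B (matching_graph n)"
    by auto
  have verts: "verts R = V" "verts B = V" and finV: "finite V"
    using col by (auto simp: two_edge_coloring_def V_def)
  have F_edge: "card e = 2 \<and> e \<subseteq> V" if "e \<in> F" for e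
  proof -
    have "e \<in> edges ?G"
      using col that by (auto simp: two_edge_coloring_def F_def)
    then show ?thesis
      by (rule edges_complete_multipartiteE) (auto simp: V_def)
  qed
  have finF: "finite F"
    using F_edge finV by (meson Pow_iff finite_Pow_iff finite_subset subsetI)
  \<comment> \<open>Injectivity of \<open>fst\<close> puts the vertices of \<open>S\<close> into
    different parts, so every pair that is not blue is a red edge.\<close>
  have no_K4: False
    if "S \<subseteq> V" "card S = 4" "inj_on fst S"
      and "\<And>x y. x \<in> S \<Longrightarrow> y \<in> S \<Longrightarrow> x \<noteq> y \<Longrightarrow> {x, y} \<notin> F" for S
  proof -
    have "{x, y} \<in> edges R" if xy: "x \<in> S" "y \<in> S" "x \<noteq> y" for x y
    proof -
      have "{x, y} \<in> edges ?G"
        using xy \<open>S \<subseteq> V\<close> \<open>inj_on fst S\<close>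
        unfolding doubleton_in_edges_complete_multipartite V_def by (auto dest: inj_onD)
      moreover have "edges R \<union> F = edges ?G"
        using col by (simp add: two_edge_coloring_def F_def)
      ultimately show ?thesis
        using that(1-3) \<open>\<And>x y. x \<in> S \<Longrightarrow> y \<in> S \<Longrightarrow> x \<noteq> y \<Longrightarrow> {x, y} \<notin> F\<close> by blast
    qed
    then have "contains_copy R (complete_graph 4)"
      using that(1,2) finV verts by (intro contains_copy_complete_graphI[of S]) (auto intro: finite_subset)
    then show False
      using noR by blast
  qed

  obtain M where M: "M \<subseteq> F" "pairwise disjnt M"
    and max: "\<And>N. N \<subseteq> F \<Longrightarrow> pairwise disjnt N \<Longrightarrow> card N \<le> card M"
    using maximum_matching_exists[OF finF] by blast
  have finM: "finite M"
    using M(1) finF finite_subset by blast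
  have cM: "card M < n"
    using noB contains_copy_matching_graphI[of M B n] M finM F_edge verts
    by (force simp: F_def)
  define U where "U = V - \<Union>M"
  have finU: "finite U"
    using finV by (simp add: U_def)
  have "card (\<Union>M) = (\<Sum>e\<in>M. card e)"
    using M F_edge by (intro card_Union_disjoint) (auto intro: finite_subset[OF _ finV])
  also have "\<dots> = 2 * card M"
    using M(1) F_edge by (subst sum.cong[where h = "\<lambda>_. 2"]) auto
  finally have "card (\<Union>M) = 2 * card M" .
  moreover have "card V \<le> card (U \<union> \<Union>M)"
    using M(1) F_edge finV finU finM
    by (intro card_mono) (auto simp: U_def intro: finite_subset[OF _ finV])
  then have "card V \<le> card U + card (\<Union>M)"
    using card_Un_le le_trans by blast
  moreover have "card V = (j - 2) * t + 2 * t"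
    using j by (simp add: V_def diff_mult_distrib)
  \<comment> \<open>\<open>M\<close> covers at most \<open>2 * n - 2\<close> vertices, while
    \<open>V\<close> has at least \<open>2 * n + 2 * t\<close>.\<close>
  ultimately have cU: "card U \<ge> 2 * t + 2"
    using large cM by linarith

  \<comment> \<open>A blue edge inside \<open>U\<close> could be added to \<open>M\<close>, against
    maximality.\<close>
  have indep: "{x, y} \<notin> F" if "x \<in> U" "y \<in> U" "x \<noteq> y" for x y
  proof
    assume "{x, y} \<in> F"
    then have "insert {x, y} M \<subseteq> F" "pairwise disjnt (insert {x, y} M)"
      using M that by (auto simp: pairwise_insert disjnt_def U_def)
    then have "card (insert {x, y} M) \<le> card M"
      by (rule max)
    moreover have "{x, y} \<notin> M"
      using that by (auto simp: U_def)
    ultimately show False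
      using finM by simp
  qed

  define P where "P = fst ` U"
  define A where "A p = {u \<in> U. fst u = p}" for p
  have finP: "finite P"
    using finU by (simp add: P_def)
  have cA: "card (A p) \<le> t" for p
  proof -
    have "A p \<subseteq> {p} \<times> {..<t}"
      by (auto simp: A_def U_def V_def)
    from card_mono[OF _ this] show ?thesis
      by simp
  qed
  have sumA: "card U = (\<Sum>p\<in>P. card (A p))"
  proof -
    have "U = (\<Union>p\<in>P. A p)"
      by (auto simp: A_def P_def)
    moreover have "card (\<Union>p\<in>P. A p) = (\<Sum>p\<in>P. card (A p))"
      using finP finU by (intro card_UN_disjoint) (auto simp: A_def)
    ultimately show ?thesis
      by simp
  qed
  \<comment> \<open>One vertex of \<open>U\<close> from each of four parts would span a red
    \<open>complete_graph 4\<close>.\<close>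
  have "card P \<le> 3"
  proof (rule ccontr)
    assume "\<not> card P \<le> 3"
    then obtain Q where Q: "Q \<subseteq> P" "card Q = 4"
      using obtain_subset_with_card_n[of 4 P] by auto
    then obtain S where S: "S \<subseteq> U" "inj_on fst S" "Q = fst ` S"
      unfolding P_def by (metis subset_image_inj)
    then have "S \<subseteq> V" "card S = 4"
      using Q(2) by (auto simp: card_image U_def)
    then show False
      using no_K4[of S] S(1,2) indep by blast
  qed
  moreover have "card P > 2"
  proof (rule ccontr)
    assume "\<not> card P > 2"
    then have "card P * t \<le> 2 * t"
      by (intro mult_right_mono) auto
    moreover have "card U \<le> card P * t"
      unfolding sumA using sum_bounded_above[of P "\<lambda>p. card (A p)" t] cA by simp
    ultimately show False
      using cU by linarith
  qed
  ultimately have cP: "card P = 3"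
    by simp
  \<comment> \<open>The other two parts contain at most \<open>2 * t\<close> vertices of
    \<open>U\<close>.\<close>
  have A2: "card (A p) \<ge> 2" if "p \<in> P" for p
  proof -
    have "card U = card (A p) + (\<Sum>q\<in>P - {p}. card (A q))"
      unfolding sumA using finP that by (rule sum.remove)
    moreover have "(\<Sum>q\<in>P - {p}. card (A q)) \<le> 2 * t"
      using sum_bounded_above[of "P - {p}" "\<lambda>p. card (A p)" t] cA cP that finP by simp
    ultimately show ?thesis
      using cU by linarith
  qed

  \<comment> \<open>The vertex \<open>x\<close> to be avoided allows the augmentation below to
    choose two distinct ends in \<open>U\<close>.\<close>
  have nbrs: "\<exists>u\<in>U. u \<noteq> x \<and> {v, u} \<in> F" if v: "v \<in> V" "fst v \<notin> P" for v x
  proof -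
    have "\<exists>p\<in>P. \<forall>u\<in>A p. {v, u} \<in> F"
    proof (rule ccontr)
      assume "\<not> ?thesis"
      \<comment> \<open>In each of the three parts \<open>h\<close> picks a vertex of
        \<open>U\<close> not joined to \<open>v\<close> in blue; together with \<open>v\<close>
        these form a red \<open>complete_graph 4\<close>.\<close>
      then obtain h where h: "\<And>p. p \<in> P \<Longrightarrow> h p \<in> A p \<and> {v, h p} \<notin> F"
        by metis
      have fst_h: "fst (h p) = p" "h p \<in> U" if "p \<in> P" for p
        using h[OF that] by (auto simp: A_def)
      have "v \<notin> h ` P"
        using fst_h(1) v(2) by auto
      moreover have "inj_on h P"
        using fst_h(1) by (metis inj_onI)
      ultimately have card: "card (insert v (h ` P)) = 4"
        using cP finP by (simp add: card_image)
      have "insert v (h ` P) \<subseteq> V"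
        using v fst_h by (auto simp: U_def)
      moreover note card
      moreover have "inj_on fst (insert v (h ` P))"
        using v fst_h by (auto simp: inj_on_def)
      moreover have "{x, y} \<notin> F"
        if "x \<in> insert v (h ` P)" "y \<in> insert v (h ` P)" "x \<noteq> y" for x y
        using that h indep[OF fst_h(2) fst_h(2)] by (auto simp: insert_commute)
      ultimately show False
        by (rule no_K4)
    qed
    then obtain p where p: "p \<in> P" "\<forall>u\<in>A p. {v, u} \<in> F"
      by blast
    have "\<not> A p \<subseteq> {x}"
      using A2[OF p(1)] card_mono[of "{x}" "A p"] by auto
    then show ?thesis
      using p(2) by (auto simp: A_def)
  qed

  \<comment> \<open>Here \<open>j \<ge> 4\<close> enters: some part \<open>q\<close> misses
    \<open>U\<close>, so \<open>M\<close> covers all of its vertices.\<close>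
  have "\<not> {..<j} \<subseteq> P"
    using card_mono[OF finP, of "{..<j}"] cP j by auto
  then obtain q where q: "q < j" "q \<notin> P"
    by auto
  define Q where "Q = {q} \<times> {..<t}"
  have Q: "v \<in> V \<and> fst v \<notin> P \<and> v \<notin> U" if "v \<in> Q" for v
    using that q by (auto simp: Q_def V_def P_def image_iff)
  have "\<exists>w. {v, w} \<in> M \<and> v \<noteq> w" if v: "v \<in> Q" for v
  proof -
    obtain e where e: "e \<in> M" "v \<in> e"
      using Q[OF v] by (auto simp: U_def)
    then obtain a b where "e = {a, b}" "a \<noteq> b"
      using F_edge M(1) by (meson card_2_iff subsetD)
    moreover from this have "{b, a} \<in> M" "v = a \<or> v = b"
      using e by (auto simp: insert_commute)
    ultimately show ?thesis
      using e(1) by blast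
  qed
  then obtain w where w: "\<And>v. v \<in> Q \<Longrightarrow> {v, w v} \<in> M \<and> v \<noteq> w v"
    by metis
  have wP: "w v \<in> P \<times> {..<t} - U" if v: "v \<in> Q" for v
  proof -
    have wV: "w v \<in> V" "w v \<notin> U"
      using w[OF v] M(1) F_edge by (auto simp: U_def)
    have "fst (w v) \<in> P"
    proof (rule ccontr)
      assume "fst (w v) \<notin> P"
      \<comment> \<open>If the partner also lay outside the three parts, both ends of the matching
        edge would have blue neighbours in \<open>U\<close>. Choosing \<open>u\<close> different
        from \<open>u'\<close> then augments \<open>M\<close>.\<close>
      then obtain u' where u': "u' \<in> U" "{w v, u'} \<in> F"
        using nbrs wV by blast
      obtain u where u: "u \<in> U" "u \<noteq> u'" "{v, u} \<in> F"
        using nbrs Q[OF v] by blast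
      let ?N = "insert {v, u} (insert {w v, u'} (M - {{v, w v}}))"
      have "pairwise disjnt ?N" "card ?N = Suc (card M)"
        using matching_augment[OF finM M(2), of v "w v" u u'] w[OF v] u u' by (auto simp: U_def)
      moreover have "?N \<subseteq> F"
        using M(1) u u' by auto
      ultimately show False
        using max[of ?N] by simp
    qed
    then show ?thesis
      using wV by (auto simp: V_def mem_Times_iff)
  qed
  have "inj_on w Q"
  proof (rule inj_onI)
    fix x y assume xy: "x \<in> Q" "y \<in> Q" "w x = w y"
    then have "\<not> disjnt {x, w x} {y, w y}"
      by (auto simp: disjnt_def)
    then have "{x, w x} = {y, w y}"
      using pairwiseD[OF M(2)] w xy(1,2) by blast
    then show "x = y"
      using xy(3) by (auto simp: doubleton_eq_iff)
  qed
  then have "card Q \<le> card (P \<times> {..<t} - U)"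
    by (rule card_inj_on_le) (use wP finP in blast)+
  moreover have "fst ` U \<subseteq> P" "U \<subseteq> V"
    by (auto simp: P_def U_def)
  then have "U \<subseteq> P \<times> {..<t}"
    by (force simp: V_def)
  \<comment> \<open>The bound \<open>card U \<le> 3 * t\<close> makes the truncated subtraction
    exact. The injection \<open>w\<close> gives \<open>t \<le> 3 * t - card U\<close>, which
    contradicts \<open>cU\<close>.\<close>
  then have "card (P \<times> {..<t} - U) = 3 * t - card U" "card U \<le> 3 * t"
    using finU finP cP card_mono[of "P \<times> {..<t}" U]
    by (simp_all add: card_Diff_subset card_cartesian_product)
  ultimately show False
    using cU by (simp add: Q_def card_cartesian_product)
qed

section \<open>The exact value\<close>

theorem theorem13:
  fixes j n :: nat
  assumes "j \<ge> 2" and "n \<ge> 1"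
  shows "multipartite_ramsey j (complete_graph 4) (matching_graph n) =
    (if j \<in> {2, 3} then \<infinity> else enat (nat \<lceil>2 * real n / (real j - 2)\<rceil>))"
proof (cases "j \<le> 3")
  case True
  then show ?thesis
    using assms not_multipartite_arrows[of n j] by (auto simp: multipartite_ramsey_def)
next
  case False
  then have j: "j \<ge> 4"
    by simp
  let ?m = "nat \<lceil>2 * real n / (real j - 2)\<rceil>"
  \<comment> \<open>The two bounds are complementary, so arrowing means
    \<open>2 * n \<le> (j - 2) * t\<close>. Dividing by the positive \<open>j - 2\<close> turns this
    into the ceiling threshold.\<close>
  have arrows: "multipartite_arrows j t (complete_graph 4) (matching_graph n) \<longleftrightarrow> ?m \<le> t" for t
  proof -
    have "?m \<le> t \<longleftrightarrow> 2 * real n / (real j - 2) \<le> real t"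
      by (simp add: nat_le_iff ceiling_le_iff)
    also have "\<dots> \<longleftrightarrow> real (2 * n) \<le> real ((j - 2) * t)"
      using j by (simp add: divide_le_eq of_nat_diff mult.commute)
    also have "\<dots> \<longleftrightarrow> 2 * n \<le> (j - 2) * t"
      by (rule of_nat_le_iff)
    finally show ?thesis
      using not_multipartite_arrows[of n j t] multipartite_arrows_K4_matching[of j n t] assms(2) j
      by fastforce
  qed
  \<comment> \<open>The threshold is itself positive, so the restriction to \<open>t \<ge> 1\<close>
    leaves the minimum unchanged.\<close>
  have "?m \<ge> 1"
    using assms(2) j by (simp add: Suc_le_eq)
  then have "(LEAST t. t \<ge> 1 \<and> ?m \<le> t) = ?m"
    by (intro Least_equality) auto
  then show ?thesis
    using \<open>?m \<ge> 1\<close> False assms(1) unfolding multipartite_ramsey_def arrows by auto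
qed

end
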